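(* Let $q$ be a prime power, let $\{C_1,\dots,C_m\}$ be an LCD subspace code in $\mathbb F_q^n$, and let $C\le \mathbb F_q^n$ be a subspace. Then, for every $i\in\{1,\dots,m\}$, $$d_s(C_i,C)=\dim(C_i)+2\dim\bigl(\pi_{C_i^\perp}(C)\bigr)-\dim(C).$$
   Context: For a subspace $U\subseteq\mathbb F_q^n$, $U^\perp$ denotes its orthogonal complement with respect to the Euclidean inner product $\langle u,v\rangle=\sum_i u_iv_i$. A subspace code is a nonempty set of subspaces of $\mathbb F_q^n$. A subspace code $C_S$ is an LCD subspace code if $U\cap W^\perp=\{0\}$ for all $U,W\in C_S$ (including $U=W$). The subspace distance is $d_s(U,W)=\dim(U+W)-\dim(U\cap W)$. If $U\cap U^\perp=\{0\}$, then $\mathbb F_q^n=U\oplus U^\perp$, and $\pi_{U^\perp}:\mathbb F_q^n\to U^\perp$ denotes the projection onto $U^\perp$ along $U$; $\pi_{U^\perp}(C)$ is the image of the subspace $C$. *)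

theory Defs
  imports "HOL-Analysis.Analysis"
begin

(* F_q is a type 'a :: {field, finite} and F_q^n is 'a ^ 'n, so q = CARD('a) and n = CARD('n).
   On this type the constants vec.subspace and vec.dim are the subspace predicate and the
   dimension over 'a (the unqualified subspace and dim are over the reals). *)

definition perp :: "('a::field ^ 'n) set \<Rightarrow> ('a ^ 'n) set" where
  "perp U = {v. \<forall>u\<in>U. scalar_product u v = 0}"

definition subspace_code :: "('a::field ^ 'n) set set \<Rightarrow> bool" where
  "subspace_code CS \<longleftrightarrow> CS \<noteq> {} \<and> (\<forall>U\<in>CS. vec.subspace U)"

definition lcd_subspace_code :: "('a::field ^ 'n) set set \<Rightarrow> bool" where
  "lcd_subspace_code CS \<longleftrightarrow>
     subspace_code CS \<and> (\<forall>U\<in>CS. \<forall>W\<in>CS. U \<inter> perp W = {0})"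

(* U + W is the elementwise sum of sets from HOL-Library.Set_Algebras. *)
definition subspace_dist :: "('a::field ^ 'n) set \<Rightarrow> ('a ^ 'n) set \<Rightarrow> int" where
  "subspace_dist U W = int (vec.dim (U + W)) - int (vec.dim (U \<inter> W))"

(* The projection onto perp U along U. The component w is uniquely determined only if
   the space is the direct sum of U and perp U, i.e. U \<inter> perp U = {0} for a subspace U;
   the value is unspecified otherwise. *)
definition proj_perp :: "('a::field ^ 'n) set \<Rightarrow> 'a ^ 'n \<Rightarrow> 'a ^ 'n" where
  "proj_perp U v = (THE w. w \<in> perp U \<and> (\<exists>u\<in>U. v = u + w))"

end

theory Submission
  imports Defs
begin

text \<open>
  Write \<open>U\<close> for the code word \<open>Cs i\<close>. The LCD condition for the pair \<open>(U, U)\<close> makes \<open>U\<close> meet its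
  orthogonal complement trivially, and then the whole space is \<open>U \<oplus> perp U\<close>
  (lemma \<open>nondegenerate_decomposition\<close>). Over a finite field this does not come from positivity
  of the inner product; instead, the form is turned into an endomorphism of \<open>U\<close> whose kernel is
  \<open>U \<inter> perp U\<close>, and such an endomorphism is onto as soon as it is injective.

  Projecting along \<open>U\<close> changes a vector only by an element of \<open>U\<close>, hence
  \<open>U + C = U + proj_perp U ` C\<close>, and the second sum is direct. So
  \<open>dim (U + C) = dim U + dim (proj_perp U ` C)\<close>. Eliminating \<open>dim (U \<inter> C)\<close> from the distance by
  the dimension formula leaves \<open>2 dim (U + C) - dim U - dim C\<close>, which is the claim.
\<close>

lemma scalar_product_add_right:
  "scalar_product u (v + w) = scalar_product u v + scalar_product u w"
  for u v w :: "'a::field ^ 'n"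
  by (simp add: scalar_product_def algebra_simps sum.distrib)

lemma scalar_product_scale_right: "scalar_product u (c *s v) = c * scalar_product u v"
  for u v :: "'a::field ^ 'n"
  by (simp add: scalar_product_def algebra_simps sum_distrib_left)

lemma scalar_product_commute: "scalar_product u v = scalar_product v u"
  for u v :: "'a::field ^ 'n"
  by (simp add: scalar_product_def mult.commute)

lemma scalar_product_zero_right: "scalar_product u 0 = 0"
  for u :: "'a::field ^ 'n"
  by (simp add: scalar_product_def)

lemma subspace_perp: "vec.subspace (perp U)"
  unfolding vec.subspace_def perp_def
  by (simp add: scalar_product_add_right scalar_product_scale_right scalar_product_zero_right)

lemma perp_if_orthogonal_to_spanning:
  fixes B :: "('a::field ^ 'n) set"
  assumes "U \<subseteq> vec.span B" and "\<And>b. b \<in> B \<Longrightarrow> scalar_product b v = 0"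
  shows "v \<in> perp U"
proof -
  have "B \<subseteq> perp {v}"
    using assms(2) by (auto simp: perp_def scalar_product_commute[of v])
  then have "U \<subseteq> perp {v}"
    using assms(1) vec.span_minimal[OF _ subspace_perp] by blast
  then show ?thesis
    by (auto simp: perp_def scalar_product_commute[of v])
qed

text \<open>
  For a basis \<open>B\<close> of \<open>U\<close>, the map \<open>g v = (\<Sum>b\<in>B. \<langle>b, v\<rangle> b)\<close> sends the whole space linearly into
  \<open>U\<close> with kernel \<open>perp U\<close>. Nondegeneracy makes it injective on \<open>U\<close>, so \<open>g ` U = U\<close> by dimension,
  and any \<open>v\<close> has the same image as some \<open>u \<in> U\<close>; then \<open>v - u\<close> is orthogonal to \<open>U\<close>.
\<close>

lemma nondegenerate_decomposition:
  fixes U :: "('a::field ^ 'n) set"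
  assumes U: "vec.subspace U" and nondeg: "U \<inter> perp U = {0}"
  obtains u w where "u \<in> U" "w \<in> perp U" "v = u + w"
proof -
  obtain B where B: "B \<subseteq> U" "vec.independent B" "U \<subseteq> vec.span B"
    using vec.maximal_independent_subset[of U] by blast
  have finB: "finite B"
    using B(2) by (rule vec.finiteI_independent)
  define g where "g v = (\<Sum>b\<in>B. scalar_product b v *s b)" for v
  have lin: "Vector_Spaces.linear (*s) (*s) g"
    by unfold_locales
      (simp_all add: g_def scalar_product_add_right scalar_product_scale_right
        vec.scale_left_distrib sum.distrib vec.scale_sum_right)
  have g_in: "g x \<in> U" for x
    unfolding g_def using B(1)
    by (intro vec.subspace_sum[OF U] vec.subspace_scale[OF U]) auto
  have ker: "x \<in> perp U" if "g x = 0" for x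
  proof (rule perp_if_orthogonal_to_spanning[OF B(3)])
    show "scalar_product b x = 0" if "b \<in> B" for b
      using vec.independentD[OF B(2) finB order_refl _ that, of "\<lambda>b. scalar_product b x"] \<open>g x = 0\<close>
      by (simp add: g_def)
  qed
  have "inj_on g U"
  proof (rule inj_onI)
    fix x y assume "x \<in> U" "y \<in> U" "g x = g y"
    then have "g (x - y) = 0" and "x - y \<in> U"
      using vec.linear_diff[OF lin] vec.subspace_diff[OF U] by auto
    then have "x - y \<in> U \<inter> perp U"
      using ker by blast
    then show "x = y"
      by (simp add: nondeg)
  qed
  then have "vec.dim (g ` U) = vec.dim U"
    using vec.dim_image_eq[OF lin, of U] by (simp only: vec.span_eq_iff[THEN iffD2, OF U])
  then have "g ` U = U"
    using g_in by (intro vec.subspace_dim_equal vec.linear_subspace_image[OF lin] U) auto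
  then obtain u where u: "u \<in> U" "g u = g v"
    using g_in[of v] by (metis imageE)
  then have "v - u \<in> perp U"
    by (intro ker) (simp add: vec.linear_diff[OF lin])
  then show thesis
    using that[of u "v - u"] u(1) by simp
qed

lemma nondegenerate_decomposition_unique:
  fixes U :: "('a::field ^ 'n) set"
  assumes U: "vec.subspace U" and nondeg: "U \<inter> perp U = {0}"
    and "u \<in> U" "u' \<in> U" "w \<in> perp U" "w' \<in> perp U" "u + w = u' + w'"
  shows "w = w'"
proof -
  have "w - w' = u' - u"
    using assms(7) by (simp add: algebra_simps)
  moreover have "u' - u \<in> U"
    using U assms(3,4) by (simp add: vec.subspace_diff)
  moreover have "w - w' \<in> perp U"
    using assms(5,6) by (simp add: subspace_perp vec.subspace_diff)
  ultimately have "w - w' \<in> U \<inter> perp U"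
    by (simp only: Int_iff)
  then show ?thesis
    by (simp add: nondeg)
qed

lemma proj_perp_eqI:
  fixes U :: "('a::field ^ 'n) set"
  assumes "vec.subspace U" "U \<inter> perp U = {0}" "w \<in> perp U" "u \<in> U" "v = u + w"
  shows "proj_perp U v = w"
  unfolding proj_perp_def
proof (rule the_equality)
  show "w \<in> perp U \<and> (\<exists>u\<in>U. v = u + w)"
    using assms(3-5) by blast
next
  fix w' assume "w' \<in> perp U \<and> (\<exists>u\<in>U. v = u + w')"
  then obtain u' where w': "w' \<in> perp U" "u' \<in> U" "u' + w' = u + w"
    using assms(5) by auto
  show "w' = w"
    by (rule nondegenerate_decomposition_unique[OF assms(1,2) w'(2) assms(4) w'(1) assms(3) w'(3)])
qed

context
  fixes U :: "('a::field ^ 'n) set"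
  assumes U: "vec.subspace U" and nondeg: "U \<inter> perp U = {0}"
begin

lemma proj_perp_mem: "proj_perp U v \<in> perp U"
  and diff_proj_perp_mem: "v - proj_perp U v \<in> U"
proof -
  obtain u w where uw: "u \<in> U" "w \<in> perp U" "v = u + w"
    using nondegenerate_decomposition[OF U nondeg] .
  then have "proj_perp U v = w"
    using proj_perp_eqI[OF U nondeg] by blast
  with uw show "proj_perp U v \<in> perp U" "v - proj_perp U v \<in> U"
    by simp_all
qed

lemma linear_proj_perp: "Vector_Spaces.linear (*s) (*s) (proj_perp U)"
proof unfold_locales
  fix x y :: "'a ^ 'n" and c :: 'a
  show "proj_perp U (x + y) = proj_perp U x + proj_perp U y"
    using vec.subspace_add[OF subspace_perp proj_perp_mem[of x] proj_perp_mem[of y]]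
      vec.subspace_add[OF U diff_proj_perp_mem[of x] diff_proj_perp_mem[of y]]
    by (rule proj_perp_eqI[OF U nondeg]) simp
  show "proj_perp U (c *s x) = c *s proj_perp U x"
    using vec.subspace_scale[OF subspace_perp proj_perp_mem[of x], of c]
      vec.subspace_scale[OF U diff_proj_perp_mem[of x], of c]
    by (rule proj_perp_eqI[OF U nondeg]) (simp add: vec.scale_right_diff_distrib)
qed

lemma sum_proj_perp_image: "U + proj_perp U ` C = U + C"
proof
  show "U + proj_perp U ` C \<subseteq> U + C"
  proof
    fix z assume "z \<in> U + proj_perp U ` C"
    then obtain u c where "u \<in> U" "c \<in> C" and z: "z = u + proj_perp U c"
      by (auto elim!: set_plus_elim)
    then have "(u - (c - proj_perp U c)) + c \<in> U + C"
      by (intro set_plus_intro vec.subspace_diff[OF U] diff_proj_perp_mem)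
    then show "z \<in> U + C"
      by (simp add: z)
  qed
  show "U + C \<subseteq> U + proj_perp U ` C"
  proof
    fix z assume "z \<in> U + C"
    then obtain u c where "u \<in> U" "c \<in> C" and z: "z = u + c"
      by (auto elim!: set_plus_elim)
    then have "(u + (c - proj_perp U c)) + proj_perp U c \<in> U + proj_perp U ` C"
      by (intro set_plus_intro vec.subspace_add[OF U] diff_proj_perp_mem imageI)
    then show "z \<in> U + proj_perp U ` C"
      by (simp add: z)
  qed
qed

end

lemma dim_set_plus_Int:
  fixes S T :: "('a::field ^ 'n) set"
  assumes "vec.subspace S" "vec.subspace T"
  shows "vec.dim (S + T) + vec.dim (S \<inter> T) = vec.dim S + vec.dim T"
proof -
  have "S + T = {x + y |x y. x \<in> S \<and> y \<in> T}"
    by (auto simp: set_plus_def)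
  then show ?thesis
    using vec.dim_sums_Int[OF assms] by simp
qed

lemma dim_sum_eq_dim_proj_perp:
  fixes U C :: "('a::field ^ 'n) set"
  assumes U: "vec.subspace U" and nondeg: "U \<inter> perp U = {0}" and C: "vec.subspace C"
  shows "vec.dim (U + C) = vec.dim U + vec.dim (proj_perp U ` C)"
proof -
  have sub: "vec.subspace (proj_perp U ` C)"
    using linear_proj_perp[OF U nondeg] C by (rule vec.linear_subspace_image)
  have "U \<inter> proj_perp U ` C \<subseteq> {0}"
    using proj_perp_mem[OF U nondeg] nondeg by blast
  then have "vec.dim (U \<inter> proj_perp U ` C) = 0"
    by (simp add: vec.dim_eq_0)
  with dim_set_plus_Int[OF U sub] show ?thesis
    by (simp add: sum_proj_perp_image[OF U nondeg])
qed

theorem lemma3: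
  fixes Cs :: "nat \<Rightarrow> ('a::{field,finite} ^ 'n) set"
    and C :: "('a ^ 'n) set"
    and m i :: nat
  assumes "lcd_subspace_code (Cs ` {1..m})"
    and "vec.subspace C"
    and "i \<in> {1..m}"
  shows "subspace_dist (Cs i) C
           = int (vec.dim (Cs i)) + 2 * int (vec.dim (proj_perp (Cs i) ` C)) - int (vec.dim C)"
proof -
  have U: "vec.subspace (Cs i)" and nondeg: "Cs i \<inter> perp (Cs i) = {0}"
    using assms(1,3) unfolding lcd_subspace_code_def subspace_code_def by blast+
  show ?thesis
    using dim_set_plus_Int[OF U assms(2)] dim_sum_eq_dim_proj_perp[OF U nondeg assms(2)]
    unfolding subspace_dist_def by linarith
qed

end
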